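(* Let $\varepsilon>0$ and consider the greedy procedure described in the context with tolerance $\varepsilon$, together with the constant $\gamma=\frac{1}{C_{\varphi^*}+C_\Lambda}$. Then this procedure is a weak greedy algorithm with constant $\gamma$ for the set $\mathcal{M}=\{\varphi_\mu^*(T):\mu\in\mathcal{P}\}$; that is, in every iteration $k$ in which the termination criterion is not fulfilled (so that a new element $\varphi_{\mu_{k+1}}^*(T)$ is selected), one has $$\operatorname{dist}\big(X^k,\{\varphi_{\mu_{k+1}}^*(T)\}\big)\;\ge\;\gamma\cdot\operatorname{dist}(X^k,\mathcal{M}).$$ Furthermore, the resulting reduced space $X^N\subset X$ (returned upon termination) satisfies, for all parameters $\mu\in\mathcal{P}$, $$\operatorname{dist}\big(X^N,\{\varphi_\mu^*(T)\}\big)\;\le\;\varepsilon.$$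
   Context: $X\neq\{0\}$ and $U$ are real Hilbert spaces (possibly infinite-dimensional), and $\mathcal{L}(V,W)$ denotes the bounded linear operators from $V$ to $W$; $I$ is the identity on $X$; norms without index are those of $X$ (or, for parameters, of the Banach space containing $\mathcal{P}$). $T>0$ is a final time. $\mathcal{P}$ is a nonempty compact subset of a Banach space. For each $\mu\in\mathcal{P}$ we are given $A_\mu\in\mathcal{L}(X,X)$, $B_\mu\in\mathcal{L}(U,X)$, an initial state $x_\mu^0\in X$ and a target state $x_\mu^T\in X$; the four maps $\mu\mapsto A_\mu,\ B_\mu,\ x_\mu^0,\ x_\mu^T$ are Lipschitz continuous on $\mathcal{P}$. $M\in\mathcal{L}(X,X)$ is self-adjoint and positive-semidefinite; $R\in\mathcal{L}(U,U)$ is self-adjoint with $R\ge\alpha I$ for some $\alpha>0$. $A^*$ denotes the Hilbert space adjoint. The weighted controllability Gramian is $$\Lambda_\mu^R:=\int_0^T e^{A_\mu(T-s)}B_\mu R^{-1}B_\mu^*e^{A_\mu^*(T-s)}\,ds\in\mathcal{L}(X,X).$$ Standing assumption: for all $\mu\in\mathcal{P}$ the operator $M\Lambda_\mu^R$ is positive-semidefinite, i.e. $\langle M\Lambda_\mu^R p,p\rangle\ge 0$ for all $p\in X$. The optimal final time adjoint $\varphi_\mu^*(T)\in X$ is the value at time $T$ of the adjoint state of the optimality system $\dot x=A_\mu x+B_\mu u$, $-\dot\varphi=A_\mu^*\varphi$, $u=-R^{-1}B_\mu^*\varphi$ on $[0,T]$, $x(0)=x_\mu^0$, $\varphi(T)=M(x(T)-x_\mu^T)$;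 equivalently, it is the solution of $(I+M\Lambda_\mu^R)\varphi_\mu^*(T)=M(e^{A_\mu T}x_\mu^0-x_\mu^T)$. The error estimator is $\eta_\mu(p):=\|M(e^{A_\mu T}x_\mu^0-x_\mu^T)-(I+M\Lambda_\mu^R)p\|$ for $p\in X$. For a subspace $Y\subset X$ and a compact set $Z\subset X$, $\operatorname{dist}(Y,Z):=\sup_{z\in Z}\inf_{y\in Y}\|y-z\|$. Constants: since $\mathcal{P}$ is compact, the four maps $\mu\mapsto A_\mu,\ B_\mu,\ x_\mu^0,\ x_\mu^T$ are Lipschitz continuous on $\mathcal{P}$, and $M\Lambda_\mu^R$ is positive-semidefinite for all $\mu\in\mathcal{P}$, the map $\mathcal{P}\ni\mu\mapsto\varphi_\mu^*(T)\in X$ is Lipschitz continuous; $C_{\varphi^*}\ge 0$ denotes its Lipschitz constant, so that $\|\varphi_\mu^*(T)-\varphi_{\tilde\mu}^*(T)\|\le C_{\varphi^*}\|\mu-\tilde\mu\|$ for all $\mu,\tilde\mu\in\mathcal{P}$. Moreover $C_\Lambda:=\sup_{\mu\in\mathcal{P}}\|I+M\Lambda_\mu^R\|_{\mathcal{L}(X,X)}<\infty$, and $C_\Lambda\ge 1$. Thus $0<\gamma\le 1$. Greedy procedure (input: $\varepsilon>0$): 1. Set $\tilde\varepsilon:=C_\Lambda\gamma\varepsilon$ and $\delta:=\tilde\varepsilon/C_\Lambda$. Choose a finite training set $\mathcal{P}_{\mathrm{train}}\subset\mathcal{P}$ such that for every $\mu\in\mathcal{P}$ there is $\tilde\mu\in\mathcal{P}_{\mathrm{train}}$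 with $\|\mu-\tilde\mu\|\le\delta$. 2. Set $k:=0$, $\Phi^0:=\emptyset$, $X^0:=\{0\}$, $\tilde\varphi_\mu^0:=0$ for all $\mu\in\mathcal{P}_{\mathrm{train}}$, and choose $\mu_1\in\operatorname{argmax}_{\mu\in\mathcal{P}_{\mathrm{train}}}\eta_\mu(\tilde\varphi_\mu^0)$. 3. While $\eta_{\mu_{k+1}}(\tilde\varphi_{\mu_{k+1}}^k)>\tilde\varepsilon$ (the termination criterion is that this inequality fails): set $\varphi_{k+1}:=\varphi_{\mu_{k+1}}^*(T)$, $\Phi^{k+1}:=\Phi^k\cup\{\varphi_{k+1}\}$ (optionally replacing $\varphi_{k+1}$ by its Gram–Schmidt orthonormalization against $\Phi^k$, which does not change the span), $X^{k+1}:=\operatorname{span}(\Phi^{k+1})$, and increase $k$ by one. Then, for each $\mu\in\mathcal{P}_{\mathrm{train}}$, let $x_i^\mu:=(I+M\Lambda_\mu^R)\varphi_i$ ($i=1,\dots,k$), let $\alpha^\mu\in\mathbb{R}^k$ be the coefficients such that $\sum_{i=1}^k\alpha_i^\mu x_i^\mu$ is the orthogonal projection of $M(e^{A_\mu T}x_\mu^0-x_\mu^T)$ onto $Y_\mu^k:=\operatorname{span}(x_1^\mu,\dots,x_k^\mu)$, and set $\tilde\varphi_\mu^k:=\sum_{i=1}^k\alpha_i^\mu\varphi_i$. Finally choose $\mu_{k+1}\in\operatorname{argmax}_{\mu\in\mathcal{P}_{\mathrm{train}}}\eta_\mu(\tilde\varphi_\mu^k)$. 4. Upon termination, return $\Phi^N:=\Phi^k$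 and $X^N:=X^k$. A greedy construction of nested spaces $V^0=\{0\}\subset V^1\subset\cdots$ for a compact set $K$ in a Hilbert space is called a weak greedy algorithm with constant $\gamma\in(0,1]$ if each newly added element $v_{k+1}\in K$, with $V^{k+1}=V^k+\operatorname{span}(v_{k+1})$, satisfies $\operatorname{dist}(V^k,\{v_{k+1}\})\ge\gamma\operatorname{dist}(V^k,K)$. *)

theory Defs
  imports "HOL-Analysis.Analysis"
begin

unbundle inner_syntax

text \<open>
  Real Hilbert spaces are types of sort \<open>{real_inner, banach}\<close>, and bounded linear operators
  are elements of the library type \<open>'a \<Rightarrow>\<^sub>L 'b\<close>.
\<close>

section \<open>Bounded operators\<close>

text \<open>
  The type of bounded endomorphisms is not an instance of the class of normed algebras, so the
  library function \<open>exp\<close> does not apply to it; this is its power series.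
\<close>

definition blinfun_exp :: "('a::banach \<Rightarrow>\<^sub>L 'a) \<Rightarrow> ('a \<Rightarrow>\<^sub>L 'a)" where
  "blinfun_exp A = (\<Sum>n. (1 / fact n) *\<^sub>R (((o\<^sub>L) A ^^ n) id_blinfun))"

text \<open>
  The library function \<open>adjoint\<close> chooses a function satisfying the adjoint identity. On a Hilbert
  space this function exists, is unique, and is bounded and linear, so \<open>Blinfun\<close> packages it
  faithfully. Similarly, \<open>blinfun_inverse\<close> is meant for boundedly invertible operators.
\<close>

definition blinfun_adjoint ::
  "('a::{real_inner, banach} \<Rightarrow>\<^sub>L 'b::{real_inner, banach}) \<Rightarrow> ('b \<Rightarrow>\<^sub>L 'a)" where
  "blinfun_adjoint A = Blinfun (adjoint (blinfun_apply A))"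

definition blinfun_inverse ::
  "('a::real_normed_vector \<Rightarrow>\<^sub>L 'b::real_normed_vector) \<Rightarrow> ('b \<Rightarrow>\<^sub>L 'a)" where
  "blinfun_inverse A = Blinfun (inv (blinfun_apply A))"

definition selfadjoint :: "('a::real_inner \<Rightarrow>\<^sub>L 'a) \<Rightarrow> bool" where
  "selfadjoint A \<longleftrightarrow> (\<forall>x y. A x \<bullet> y = x \<bullet> A y)"

definition positive_semidefinite :: "('a::real_inner \<Rightarrow>\<^sub>L 'a) \<Rightarrow> bool" where
  "positive_semidefinite A \<longleftrightarrow> (\<forall>p. 0 \<le> A p \<bullet> p)"

section \<open>The optimal control problem for a single parameter\<close>

definition gramian ::
  "real \<Rightarrow> ('u::{real_inner, banach} \<Rightarrow>\<^sub>L 'u) \<Rightarrow> ('x::{real_inner, banach} \<Rightarrow>\<^sub>L 'x)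
    \<Rightarrow> ('u \<Rightarrow>\<^sub>L 'x) \<Rightarrow> ('x \<Rightarrow>\<^sub>L 'x)" where
  "gramian T R A B = integral {0..T} (\<lambda>s.
     blinfun_exp ((T - s) *\<^sub>R A) o\<^sub>L B o\<^sub>L blinfun_inverse R o\<^sub>L blinfun_adjoint B
       o\<^sub>L blinfun_exp ((T - s) *\<^sub>R blinfun_adjoint A))"

definition optimality_system ::
  "real \<Rightarrow> ('x::{real_inner, banach} \<Rightarrow>\<^sub>L 'x) \<Rightarrow> ('u::{real_inner, banach} \<Rightarrow>\<^sub>L 'u)
    \<Rightarrow> ('x \<Rightarrow>\<^sub>L 'x) \<Rightarrow> ('u \<Rightarrow>\<^sub>L 'x) \<Rightarrow> 'x \<Rightarrow> 'x
    \<Rightarrow> (real \<Rightarrow> 'x) \<Rightarrow> (real \<Rightarrow> 'u) \<Rightarrow> (real \<Rightarrow> 'x) \<Rightarrow> bool" where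
  "optimality_system T M R A B x0 xT x u \<phi> \<longleftrightarrow>
     (\<forall>t\<in>{0..T}. (x has_vector_derivative A (x t) + B (u t)) (at t within {0..T})) \<and>
     (\<forall>t\<in>{0..T}. (\<phi> has_vector_derivative - blinfun_adjoint A (\<phi> t)) (at t within {0..T})) \<and>
     (\<forall>t\<in>{0..T}. u t = - blinfun_inverse R (blinfun_adjoint B (\<phi> t))) \<and>
     x 0 = x0 \<and> \<phi> T = M (x T - xT)"

definition optimal_final_adjoint ::
  "real \<Rightarrow> ('x::{real_inner, banach} \<Rightarrow>\<^sub>L 'x) \<Rightarrow> ('u::{real_inner, banach} \<Rightarrow>\<^sub>L 'u)
    \<Rightarrow> ('x \<Rightarrow>\<^sub>L 'x) \<Rightarrow> ('u \<Rightarrow>\<^sub>L 'x) \<Rightarrow> 'x \<Rightarrow> 'x \<Rightarrow> 'x" where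
  "optimal_final_adjoint T M R A B x0 xT =
     (THE p. \<exists>x u \<phi>. optimality_system T M R A B x0 xT x u \<phi> \<and> p = \<phi> T)"

definition final_operator ::
  "real \<Rightarrow> ('x::{real_inner, banach} \<Rightarrow>\<^sub>L 'x) \<Rightarrow> ('u::{real_inner, banach} \<Rightarrow>\<^sub>L 'u)
    \<Rightarrow> ('x \<Rightarrow>\<^sub>L 'x) \<Rightarrow> ('u \<Rightarrow>\<^sub>L 'x) \<Rightarrow> ('x \<Rightarrow>\<^sub>L 'x)" where
  "final_operator T M R A B = id_blinfun + (M o\<^sub>L gramian T R A B)"

definition final_rhs ::
  "real \<Rightarrow> ('x::{real_inner, banach} \<Rightarrow>\<^sub>L 'x) \<Rightarrow> ('x \<Rightarrow>\<^sub>L 'x) \<Rightarrow> 'x \<Rightarrow> 'x \<Rightarrow> 'x" where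
  "final_rhs T M A x0 xT = M (blinfun_exp (T *\<^sub>R A) x0 - xT)"

section \<open>Greedy procedure\<close>

definition space_dist :: "'x::real_normed_vector set \<Rightarrow> 'x set \<Rightarrow> real" where
  "space_dist Y Z = (SUP z\<in>Z. INF y\<in>Y. norm (y - z))"

definition orth_projection :: "'x::real_inner set \<Rightarrow> 'x \<Rightarrow> 'x" where
  "orth_projection S w = (THE p. p \<in> S \<and> (\<forall>y\<in>S. orthogonal (w - p) y))"

text \<open>
  In the following definitions \<open>G\<close> stands for \<open>I + M \<Lambda>\<close> and \<open>b\<close> for \<open>M (e\<^sup>A\<^sup>T x0 - xT)\<close>: for one
  parameter in the first two definitions, and for all parameters from \<open>greedy_select\<close> on.
\<close>

definition error_estimator :: "('x::real_normed_vector \<Rightarrow>\<^sub>L 'x) \<Rightarrow> 'x \<Rightarrow> 'x \<Rightarrow> real" where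
  "error_estimator G b p = norm (b - G p)"

text \<open>
  The basis \<open>\<Phi>\<close> is a list whose entry \<open>\<Phi> ! i\<close> is the element number \<open>i + 1\<close> of the basis. For bases
  produced by the procedure the coefficients below the length of \<open>\<Phi>\<close> are unique.
\<close>

definition reduced_adjoint :: "('x::real_inner \<Rightarrow>\<^sub>L 'x) \<Rightarrow> 'x \<Rightarrow> 'x list \<Rightarrow> 'x" where
  "reduced_adjoint G b \<Phi> =
     (let \<alpha> = (SOME \<alpha> :: nat \<Rightarrow> real.
            (\<Sum>i<length \<Phi>. \<alpha> i *\<^sub>R G (\<Phi> ! i))
              = orth_projection (span (blinfun_apply G ` set \<Phi>)) b)
      in \<Sum>i<length \<Phi>. \<alpha> i *\<^sub>R \<Phi> ! i)"

definition gram_schmidt_normalized :: "'x::real_inner list \<Rightarrow> 'x \<Rightarrow> 'x" where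
  "gram_schmidt_normalized \<Phi> w = sgn (w - orth_projection (span (set \<Phi>)) w)"

definition greedy_estimate ::
  "('p \<Rightarrow> 'x::real_inner \<Rightarrow>\<^sub>L 'x) \<Rightarrow> ('p \<Rightarrow> 'x) \<Rightarrow> 'x list \<Rightarrow> 'p \<Rightarrow> real" where
  "greedy_estimate G b \<Phi> \<mu> = error_estimator (G \<mu>) (b \<mu>) (reduced_adjoint (G \<mu>) (b \<mu>) \<Phi>)"

definition greedy_select ::
  "'p set \<Rightarrow> ('p \<Rightarrow> 'x::real_inner \<Rightarrow>\<^sub>L 'x) \<Rightarrow> ('p \<Rightarrow> 'x) \<Rightarrow> 'x list \<Rightarrow> 'p \<Rightarrow> bool" where
  "greedy_select train G b \<Phi> \<nu> \<longleftrightarrow>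
     is_arg_max (greedy_estimate G b \<Phi>) (\<lambda>\<mu>. \<mu> \<in> train) \<nu>"

text \<open>
  The first \<open>N\<close> iterations of the procedure with tolerance \<open>tol\<close>, for any admissible choice of the
  maximizers. Here \<open>\<Phi> k\<close> is the basis after \<open>k\<close> iterations and \<open>\<nu> (Suc k)\<close> is the parameter
  selected by means of \<open>\<Phi> k\<close>. Whether to orthonormalize is decided freely in every step.
\<close>

definition greedy_run ::
  "'p set \<Rightarrow> real \<Rightarrow> ('p \<Rightarrow> 'x::real_inner) \<Rightarrow> ('p \<Rightarrow> 'x \<Rightarrow>\<^sub>L 'x) \<Rightarrow> ('p \<Rightarrow> 'x)
    \<Rightarrow> nat \<Rightarrow> (nat \<Rightarrow> 'p) \<Rightarrow> (nat \<Rightarrow> 'x list) \<Rightarrow> bool" where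
  "greedy_run train tol \<phi> G b N \<nu> \<Phi> \<longleftrightarrow>
     \<Phi> 0 = [] \<and>
     (\<forall>k<N. greedy_select train G b (\<Phi> k) (\<nu> (Suc k)) \<and>
            greedy_estimate G b (\<Phi> k) (\<nu> (Suc k)) > tol \<and>
            (\<exists>v \<in> {\<phi> (\<nu> (Suc k)), gram_schmidt_normalized (\<Phi> k) (\<phi> (\<nu> (Suc k)))}.
               \<Phi> (Suc k) = \<Phi> k @ [v]))"

definition greedy_terminates ::
  "'p set \<Rightarrow> real \<Rightarrow> ('p \<Rightarrow> 'x::real_inner) \<Rightarrow> ('p \<Rightarrow> 'x \<Rightarrow>\<^sub>L 'x) \<Rightarrow> ('p \<Rightarrow> 'x)
    \<Rightarrow> nat \<Rightarrow> (nat \<Rightarrow> 'p) \<Rightarrow> (nat \<Rightarrow> 'x list) \<Rightarrow> bool" where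
  "greedy_terminates train tol \<phi> G b N \<nu> \<Phi> \<longleftrightarrow>
     greedy_run train tol \<phi> G b N \<nu> \<Phi> \<and>
     greedy_select train G b (\<Phi> N) (\<nu> (Suc N)) \<and>
     \<not> greedy_estimate G b (\<Phi> N) (\<nu> (Suc N)) > tol"

definition weak_greedy ::
  "real \<Rightarrow> 'x::real_inner set \<Rightarrow> nat \<Rightarrow> (nat \<Rightarrow> 'x set) \<Rightarrow> (nat \<Rightarrow> 'x) \<Rightarrow> bool" where
  "weak_greedy \<gamma> K N V v \<longleftrightarrow>
     0 < \<gamma> \<and> \<gamma> \<le> 1 \<and> compact K \<and> V 0 = {0} \<and>
     (\<forall>k<N. v (Suc k) \<in> K \<and>
            V (Suc k) = {y + z | y z. y \<in> V k \<and> z \<in> span {v (Suc k)}} \<and>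
            space_dist (V k) {v (Suc k)} \<ge> \<gamma> * space_dist (V k) K)"

end

theory Submission
  imports Defs
begin

text \<open>
  Write \<open>G \<mu> = I + M \<Lambda>\<close>, \<open>b \<mu> = M (e\<^sup>A\<^sup>T x0 - xT)\<close> and \<open>d \<mu>\<close> for the distance of \<open>\<phi> \<mu>\<close> from the current
  reduced space. The argument rests on the two-sided estimate
  \<open>d \<mu> \<le> greedy_estimate G b \<Phi> \<mu> \<le> C_Lambda * d \<mu>\<close>
  (\<open>infdist_le_greedy_estimate\<close> and \<open>greedy_estimate_le_infdist\<close>). The left inequality holds because
  \<open>M \<Lambda>\<close> is positive-semidefinite, so \<open>G \<mu>\<close> is coercive and does not shrink norms, whence errors are
  bounded by residuals. The right one holds because the reduced adjoint is obtained by projection, so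
  that its residual is the smallest one attainable in the reduced space.

  Let \<open>\<nu>\<close> be the selected parameter and \<open>\<eta>\<close> its estimate. By Lipschitz continuity and the density of
  the training set, every parameter satisfies \<open>d \<mu> \<le> C_phi * \<delta> + \<eta>\<close> (\<open>infdist_le_training\<close>). If the
  procedure stops, then \<open>\<eta> \<le> tol = C_Lambda * \<delta>\<close>, so \<open>d \<mu> \<le> (C_phi + C_Lambda) * \<delta> = \<epsilon>\<close>. If it continues,
  then \<open>C_Lambda * \<delta> < \<eta> \<le> C_Lambda * d \<nu>\<close>, so \<open>\<delta> \<le> d \<nu>\<close> and \<open>d \<mu> \<le> (C_phi + C_Lambda) * d \<nu>\<close>, which is the
  weak greedy property (\<open>weak_greedy_inequality\<close>).

  Two facts about the control problem feed this argument. The final adjoint, described through the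
  optimality system, solves \<open>G \<mu> (\<phi> \<mu>) = b \<mu>\<close> (\<open>final_operator_optimal_final_adjoint\<close>): solving the
  adjoint and the state equation explicitly with operator exponentials turns the optimality system
  into this linear equation, and coercivity makes it uniquely solvable. Moreover the norms of the
  operators \<open>G \<mu>\<close> are bounded (\<open>bdd_above_norm_final_operator\<close>), which makes their supremum
  \<open>C_Lambda\<close> an upper bound; here the Riesz representation theorem bounds the adjoints in the Gramian.
\<close>

interpretation blinfun_comp: bounded_bilinear "(o\<^sub>L)"
  by (rule bounded_bilinear_blinfun_compose)

section \<open>Adjoints on Hilbert spaces\<close>

text \<open>
  The representing vector is the minimizer of \<open>J x = x \<bullet> x - 2 * f x\<close>: a minimizing sequence
  is Cauchy by the parallelogram identity, and since \<open>J\<close> cannot decrease from \<open>z\<close> in any direction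
  \<open>x\<close>, its derivative \<open>2 * (x \<bullet> z - f x)\<close> there vanishes.
\<close>

lemma riesz_representation:
  fixes f :: "'a::{real_inner, banach} \<Rightarrow> real"
  assumes "bounded_linear f"
  obtains z where "\<And>x. f x = x \<bullet> z"
proof -
  interpret bounded_linear f by fact
  define J where "J x = x \<bullet> x - 2 * f x" for x
  obtain K where K: "\<And>x. norm (f x) \<le> norm x * K"
    using bounded by blast
  have lower: "- (K\<^sup>2) \<le> J x" for x
  proof -
    have "f x \<le> norm x * K" using K[of x] by simp
    moreover have "0 \<le> (norm x - K)\<^sup>2" by simp
    ultimately show ?thesis
      by (simp add: J_def power2_norm_eq_inner[symmetric] power2_diff)
  qed
  then have bdd: "bdd_below (range J)" by (rule bdd_belowI2)
  define m where "m = Inf (range J)"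
  have m_le: "m \<le> J x" for x
    unfolding m_def by (rule cINF_lower[OF bdd]) simp
  have "\<exists>x. J x < m + 1 / real (Suc n)" for n
    using cInf_lessD[of "range J" "m + 1 / real (Suc n)"] by (auto simp: m_def)
  then obtain X where X: "\<And>n. J (X n) < m + 1 / real (Suc n)" by metis
  \<comment> \<open>The parallelogram identity turns nearly minimal values into nearby points.\<close>
  have gap: "(dist x y)\<^sup>2 \<le> 2 * (J x - m) + 2 * (J y - m)" for x y
  proof -
    have "m \<le> J ((1/2) *\<^sub>R (x + y))" by (rule m_le)
    also have "\<dots> = (J x + J y) / 2 - (dist x y)\<^sup>2 / 4"
      by (simp add: J_def dist_norm power2_norm_eq_inner inner_add inner_diff inner_commute
          add scaleR field_simps)
    finally show ?thesis by (simp add: field_simps)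
  qed
  have "Cauchy X"
  proof (rule metric_CauchyI)
    fix e :: real assume e: "e > 0"
    obtain N where N: "1 / real (Suc N) < e\<^sup>2 / 4"
      using e nat_approx_posE[of "e\<^sup>2 / 4"] by (metis zero_less_divide_iff zero_less_numeral zero_less_power)
    have "dist (X i) (X j) < e" if "i \<ge> N" "j \<ge> N" for i j
    proof -
      have near: "J (X n) - m < e\<^sup>2 / 4" if "n \<ge> N" for n
      proof -
        have "1 / real (Suc n) \<le> 1 / real (Suc N)"
          using that by (intro frac_le) auto
        then show ?thesis using X[of n] N by linarith
      qed
      have "(dist (X i) (X j))\<^sup>2 < e\<^sup>2"
        using gap[of "X i" "X j"] near[OF that(1)] near[OF that(2)] by argo
      then show ?thesis using e power2_less_imp_less by fastforce
    qed
    then show "\<exists>N. \<forall>i\<ge>N. \<forall>j\<ge>N. dist (X i) (X j) < e" by blast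
  qed
  then obtain z where z: "X \<longlonglongrightarrow> z" using Cauchy_convergent convergent_def by blast
  have "(\<lambda>n. J (X n)) \<longlonglongrightarrow> J z"
    unfolding J_def by (intro tendsto_intros tendsto z)
  moreover have "(\<lambda>n. m + 1 / real (Suc n)) \<longlonglongrightarrow> m"
    using LIMSEQ_inverse_real_of_nat_add[of m] by (simp add: inverse_eq_divide)
  ultimately have "J z \<le> m"
    by (rule LIMSEQ_le) (use X less_imp_le in blast)
  then have Jz: "J z \<le> J y" for y using m_le order_trans by blast
  have "f x = x \<bullet> z" for x
  proof -
    define c d where "c = x \<bullet> z - f x" and "d = x \<bullet> x"
    have d: "d \<ge> 0" by (simp add: d_def)
    have "0 \<le> 2 * t * c + t\<^sup>2 * d" for t
      using Jz[of "z + t *\<^sub>R x"]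
      by (simp add: J_def c_def d_def add scaleR inner_add inner_commute power2_eq_square algebra_simps)
    note quadratic = this
    \<comment> \<open>The minimum of the quadratic would be at \<open>- c / d\<close>; the shift avoids the case \<open>d = 0\<close> and
      still gives a negative value unless \<open>c = 0\<close>.\<close>
    define t where "t = - c / (d + 1)"
    then have c: "c = - (t * (d + 1))" using d by (simp add: field_simps)
    have "0 \<le> - (t\<^sup>2 * (d + 2))"
      using quadratic[of t] by (simp add: c power2_eq_square algebra_simps)
    then have "t = 0" using d
      by (smt (verit) mult_pos_pos zero_less_power2)
    then have "c = 0" using c by simp
    then show ?thesis by (simp add: c_def)
  qed
  then show ?thesis by (rule that)
qed

text \<open>
  The choice in the definition of the adjoint succeeds because, for fixed \<open>y\<close>, the functional
  \<open>x \<mapsto> A x \<bullet> y\<close> has a Riesz representative.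
\<close>

lemma inner_adjoint:
  fixes A :: "'a::{real_inner, banach} \<Rightarrow>\<^sub>L 'b::{real_inner, banach}"
  shows "blinfun_apply A x \<bullet> y = x \<bullet> adjoint (blinfun_apply A) y"
proof -
  have "\<exists>z. \<forall>x. A x \<bullet> y = x \<bullet> z" for y
    using riesz_representation[of "\<lambda>x. A x \<bullet> y"]
    by (metis blinfun.bounded_linear_right bounded_linear_inner_left_comp)
  then have "\<exists>f'. \<forall>x y. A x \<bullet> y = x \<bullet> f' y" by metis
  from someI_ex[OF this] show ?thesis unfolding adjoint_def by blast
qed

text \<open>
  This transfers bounds on \<open>A\<close> that are uniform in the parameter to the adjoint operators, which
  enter the Gramian.
\<close>

lemma norm_blinfun_adjoint_le:
  fixes A :: "'a::{real_inner, banach} \<Rightarrow>\<^sub>L 'b::{real_inner, banach}"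
  shows "norm (blinfun_adjoint A) \<le> norm A"
proof -
  let ?f = "adjoint (blinfun_apply A)"
  have bound: "norm (?f y) \<le> norm A * norm y" for y
  proof -
    have "norm (?f y) * norm (?f y) = A (?f y) \<bullet> y"
      by (simp add: inner_adjoint norm_eq_sqrt_inner)
    also have "\<dots> \<le> norm A * norm (?f y) * norm y"
      by (meson norm_blinfun norm_cauchy_schwarz mult_right_mono norm_ge_zero order_trans)
    finally show ?thesis by (cases "norm (?f y) = 0") (auto simp: mult_ac)
  qed
  have "bounded_linear ?f"
  proof (rule bounded_linear_intro[where K = "norm A"])
    show "?f (x + y) = ?f x + ?f y" for x y
      by (simp add: vector_eq_ldot[symmetric] inner_add_right inner_adjoint[symmetric])
    show "?f (r *\<^sub>R x) = r *\<^sub>R ?f x" for r x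
      by (simp add: vector_eq_ldot[symmetric] inner_adjoint[symmetric])
  qed (use bound in \<open>simp add: mult.commute\<close>)
  then have "blinfun_apply (blinfun_adjoint A) = ?f"
    unfolding blinfun_adjoint_def by (rule bounded_linear_Blinfun_apply)
  then show ?thesis
    using bound by (intro norm_blinfun_bound) auto
qed

section \<open>The operator exponential\<close>

interpretation blinfun_comp: bounded_bilinear "(o\<^sub>L)"
  by (rule bounded_bilinear_blinfun_compose)

lemma blinfun_compose_assoc: "(f o\<^sub>L g) o\<^sub>L h = f o\<^sub>L (g o\<^sub>L h)"
  by (rule blinfun_eqI) simp

lemma id_blinfun_compose_id: "id_blinfun o\<^sub>L id_blinfun = id_blinfun"
  by (rule blinfun_eqI) simp

text \<open>
  The scaled power series has the coefficients \<open>t ^ n / fact n\<close>, so the exponential along a ray can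
  be differentiated term by term.
\<close>

lemma compow_scaleR:
  "((o\<^sub>L) (t *\<^sub>R A) ^^ n) id_blinfun = t ^ n *\<^sub>R (((o\<^sub>L) A ^^ n) id_blinfun)"
  for A :: "'a::real_normed_vector \<Rightarrow>\<^sub>L 'a"
  by (induction n) (simp_all add: blinfun_comp.scaleR_left blinfun_comp.scaleR_right)

lemma compow_commute:
  "((o\<^sub>L) A ^^ n) id_blinfun o\<^sub>L A = A o\<^sub>L ((o\<^sub>L) A ^^ n) id_blinfun"
  for A :: "'a::real_normed_vector \<Rightarrow>\<^sub>L 'a"
  by (induction n) (auto simp: blinfun_compose_assoc intro: blinfun_eqI)

lemma norm_compow_le:
  "norm (((o\<^sub>L) A ^^ n) id_blinfun) \<le> norm A ^ n"
  for A :: "'a::real_normed_vector \<Rightarrow>\<^sub>L 'a"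
proof (induction n)
  case 0
  show ?case by (simp add: norm_blinfun_id_le)
next
  case (Suc n)
  then show ?case
    using norm_blinfun_compose[of A "((o\<^sub>L) A ^^ n) id_blinfun"]
    by (simp, meson mult_left_mono norm_ge_zero order_trans)
qed

lemma norm_exp_term_le:
  "norm ((1 / fact n) *\<^sub>R (((o\<^sub>L) A ^^ n) id_blinfun)) \<le> norm A ^ n /\<^sub>R fact n"
  for A :: "'a::real_normed_vector \<Rightarrow>\<^sub>L 'a"
  using norm_compow_le[where A = A and n = n] by (simp add: field_simps)

lemma blinfun_exp_sums:
  "(\<lambda>n. (1 / fact n) *\<^sub>R (((o\<^sub>L) A ^^ n) id_blinfun)) sums blinfun_exp A"
  for A :: "'a::banach \<Rightarrow>\<^sub>L 'a"
  unfolding blinfun_exp_def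
  by (rule summable_sums, rule summable_comparison_test', rule summable_exp_generic[of "norm A"])
     (rule norm_exp_term_le)

lemma norm_blinfun_exp_le: "norm (blinfun_exp A) \<le> exp (norm A)"
  for A :: "'a::banach \<Rightarrow>\<^sub>L 'a"
  unfolding blinfun_exp_def exp_def
  by (rule norm_suminf_le[OF norm_exp_term_le summable_exp_generic])

lemma norm_blinfun_exp_scaleR_le:
  fixes A :: "'a::banach \<Rightarrow>\<^sub>L 'a"
  assumes "0 \<le> t" "t \<le> T" "norm A \<le> a"
  shows "norm (blinfun_exp (t *\<^sub>R A)) \<le> exp (T * a)"
proof -
  have "norm (blinfun_exp (t *\<^sub>R A)) \<le> exp (t * norm A)"
    using norm_blinfun_exp_le[of "t *\<^sub>R A"] assms by simp
  also have "\<dots> \<le> exp (T * a)" using assms by (simp add: mult_mono')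
  finally show ?thesis .
qed

lemma blinfun_exp_zero [simp]: "blinfun_exp (0 :: 'a::banach \<Rightarrow>\<^sub>L 'a) = id_blinfun"
proof -
  have "(1 / fact n) *\<^sub>R (((o\<^sub>L) (0 :: 'a \<Rightarrow>\<^sub>L 'a) ^^ n) id_blinfun) = (if n = 0 then id_blinfun else 0)" for n
    by (cases n) auto
  then have "(\<lambda>n. if n = 0 then id_blinfun else 0) sums blinfun_exp (0 :: 'a \<Rightarrow>\<^sub>L 'a)"
    using blinfun_exp_sums[where A = "0 :: 'a \<Rightarrow>\<^sub>L 'a"] by presburger
  then show ?thesis
    using sums_single[of 0 "\<lambda>_. id_blinfun :: 'a \<Rightarrow>\<^sub>L 'a"] by (rule sums_unique2)
qed

text \<open>
  Each term of the power series commutes with the generator, and composition is continuous in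
  either factor.
\<close>

lemma blinfun_exp_commute:
  "blinfun_exp (t *\<^sub>R A) o\<^sub>L A = A o\<^sub>L blinfun_exp (t *\<^sub>R A)"
  for A :: "'a::banach \<Rightarrow>\<^sub>L 'a"
proof -
  note s = blinfun_exp_sums[of "t *\<^sub>R A"]
  show ?thesis
    using bounded_linear.sums[OF blinfun_comp.bounded_linear_left[of A] s]
      bounded_linear.sums[OF blinfun_comp.bounded_linear_right[of A] s]
    by (simp add: compow_scaleR blinfun_comp.scaleR_left blinfun_comp.scaleR_right
        compow_commute sums_unique2)
qed

text \<open>
  Termwise differentiation: the series of derivatives is the exponential series shifted by one
  index and composed with \<open>A\<close>, and it converges uniformly on every bounded interval by the
  Weierstrass test.
\<close>

lemma blinfun_exp_has_vector_derivative_local: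
  fixes A :: "'a::banach \<Rightarrow>\<^sub>L 'a"
  assumes "t \<in> {-r..r}"
  shows "((\<lambda>t. blinfun_exp (t *\<^sub>R A)) has_vector_derivative A o\<^sub>L blinfun_exp (t *\<^sub>R A))
           (at t within {-r..r})"
proof -
  define Q where "Q n = ((o\<^sub>L) A ^^ n) id_blinfun" for n
  define E where "E t = blinfun_exp (t *\<^sub>R A)" for t
  define f where "f n t = (t ^ n / fact n) *\<^sub>R Q n" for n and t :: real
  define D where "D n t = (real n * t ^ (n - 1) / fact n) *\<^sub>R Q n" for n and t :: real
  have sums: "(\<lambda>n. f n t) sums E t" for t
    using blinfun_exp_sums[of "t *\<^sub>R A"] by (simp add: compow_scaleR f_def E_def Q_def)
  have "norm (f n t) \<le> r ^ n * norm A ^ n / fact n" if "t \<in> {-r..r}" for n t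
  proof -
    have "\<bar>t\<bar> ^ n \<le> r ^ n" using that by (intro power_mono) auto
    then show ?thesis
      using norm_compow_le[where A = A and n = n] that
      by (auto simp: f_def Q_def power_abs divide_simps intro!: mult_mono)
  qed
  moreover have "summable (\<lambda>n. r ^ n * norm A ^ n / fact n)"
    using summable_exp_generic[of "r * norm A"] by (simp add: power_mult_distrib field_simps)
  ultimately have "uniform_limit {-r..r} (\<lambda>n t. \<Sum>i<n. f i t) (\<lambda>t. \<Sum>i. f i t) sequentially"
    by (intro Weierstrass_m_test)
  then have "uniform_limit {-r..r} (\<lambda>n t. \<Sum>i<n. f i t) E sequentially"
    using sums by (simp add: sums_iff)
  then have "uniform_limit {-r..r} (\<lambda>n t. A o\<^sub>L (\<Sum>i<n. f i t)) (\<lambda>t. A o\<^sub>L E t) sequentially"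
    by (rule bounded_linear.uniform_limit[OF blinfun_comp.bounded_linear_right])
  moreover have "A o\<^sub>L (\<Sum>i<n. f i t) = (\<Sum>i<Suc n. D i t)" for n t
  proof -
    have "A o\<^sub>L f i t = D (Suc i) t" for i
      by (simp add: f_def D_def Q_def blinfun_comp.scaleR_right divide_simps)
    moreover have "D 0 t = 0" by (simp add: D_def)
    ultimately show ?thesis
      unfolding sum.lessThan_Suc_shift by (simp add: blinfun_comp.sum_right)
  qed
  ultimately have unif: "uniform_limit {-r..r} (\<lambda>n t. \<Sum>i<n. D i t) (\<lambda>t. A o\<^sub>L E t) sequentially"
    by (simp only: filterlim_sequentially_Suc[of "\<lambda>n t. \<Sum>i<n. D i t"])
  have "\<exists>g. \<forall>t\<in>{-r..r}. (\<lambda>n. f n t) sums g t \<and>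
          (g has_derivative (\<lambda>h. h *\<^sub>R (A o\<^sub>L E t))) (at t within {-r..r})"
  proof (rule has_derivative_series[where f' = "\<lambda>n t h. h *\<^sub>R D n t"])
    show "(f n has_derivative (\<lambda>h. h *\<^sub>R D n t)) (at t within {-r..r})" for n t
      unfolding f_def D_def
      by (auto intro!: derivative_eq_intros simp: divide_inverse mult_ac)
    show "\<forall>\<^sub>F n in sequentially. \<forall>t\<in>{-r..r}. \<forall>h.
            norm ((\<Sum>i<n. h *\<^sub>R D i t) - h *\<^sub>R (A o\<^sub>L E t)) \<le> e * norm h" if "e > 0" for e
      using uniform_limitD[OF unif that]
    proof eventually_elim
      case (elim n)
      show ?case
      proof (intro ballI allI)
        fix t h :: real
        assume "t \<in> {-r..r}"
        then have "norm ((\<Sum>i<n. D i t) - (A o\<^sub>L E t)) \<le> e"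
          using elim by (force simp: dist_norm)
        then show "norm ((\<Sum>i<n. h *\<^sub>R D i t) - h *\<^sub>R (A o\<^sub>L E t)) \<le> e * norm h"
          by (simp add: scaleR_sum_right[symmetric] scaleR_diff_right[symmetric]
                mult.commute[of e] mult_left_mono)
      qed
    qed
  qed (use assms sums in auto)
  then obtain g where g: "\<And>t. t \<in> {-r..r} \<Longrightarrow> (\<lambda>n. f n t) sums g t"
    "\<And>t. t \<in> {-r..r} \<Longrightarrow> (g has_derivative (\<lambda>h. h *\<^sub>R (A o\<^sub>L E t))) (at t within {-r..r})"
    by blast
  have "(E has_derivative (\<lambda>h. h *\<^sub>R (A o\<^sub>L E t))) (at t within {-r..r})"
    by (rule has_derivative_transform[OF assms _ g(2)[OF assms]])
       (use g(1) sums in \<open>blast intro: sums_unique2\<close>)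
  then show ?thesis by (simp add: has_vector_derivative_def E_def[abs_def])
qed

lemma blinfun_exp_has_vector_derivative:
  fixes A :: "'a::banach \<Rightarrow>\<^sub>L 'a"
  shows "((\<lambda>t. blinfun_exp (t *\<^sub>R A)) has_vector_derivative A o\<^sub>L blinfun_exp (t *\<^sub>R A))
           (at t within S)"
proof -
  let ?r = "\<bar>t\<bar> + 1"
  have "at t within {-?r..?r} = at t"
    by (rule at_within_interior) (auto simp: interior_atLeastAtMost_real)
  then have "((\<lambda>t. blinfun_exp (t *\<^sub>R A)) has_vector_derivative A o\<^sub>L blinfun_exp (t *\<^sub>R A)) (at t)"
    using blinfun_exp_has_vector_derivative_local[of t ?r A] by (simp add: abs_real_def)
  then show ?thesis by (rule has_vector_derivative_at_within)
qed

lemma blinfun_exp_compose_has_vector_derivative: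
  fixes A :: "'a::banach \<Rightarrow>\<^sub>L 'a"
  assumes "(g has_real_derivative g') (at t within S)"
  shows "((\<lambda>t. blinfun_exp (g t *\<^sub>R A)) has_vector_derivative g' *\<^sub>R (A o\<^sub>L blinfun_exp (g t *\<^sub>R A)))
           (at t within S)"
  using vector_diff_chain_within[OF has_real_derivative_iff_has_vector_derivative[THEN iffD1, OF assms]
      blinfun_exp_has_vector_derivative[of A "g t" "g ` S"]]
  by (simp add: o_def)

lemma continuous_on_blinfun_exp [continuous_intros]:
  fixes A :: "'a::banach \<Rightarrow>\<^sub>L 'a"
  assumes "continuous_on S g"
  shows "continuous_on S (\<lambda>s. blinfun_exp (g s *\<^sub>R A))"
proof -
  have "continuous_on UNIV (\<lambda>t. blinfun_exp (t *\<^sub>R A))"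
    by (rule continuous_on_vector_derivative) (rule blinfun_exp_has_vector_derivative)
  from continuous_on_compose2[OF this assms] show ?thesis by simp
qed

text \<open>
  The product \<open>e\<^sup>t\<^sup>A e\<^sup>-\<^sup>t\<^sup>A\<close> has derivative zero, because \<open>A\<close> commutes with its exponential.
\<close>

lemma blinfun_exp_inverse:
  fixes A :: "'a::banach \<Rightarrow>\<^sub>L 'a"
  shows "blinfun_exp (t *\<^sub>R A) (blinfun_exp ((- t) *\<^sub>R A) v) = v"
proof -
  let ?h = "\<lambda>t. blinfun_exp (t *\<^sub>R A) o\<^sub>L blinfun_exp ((- t) *\<^sub>R A)"
  have "(?h has_derivative (\<lambda>h. 0)) (at s within UNIV)" for s
  proof -
    have "((\<lambda>t. blinfun_exp ((- t) *\<^sub>R A)) has_vector_derivative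
            (-1) *\<^sub>R (A o\<^sub>L blinfun_exp ((- s) *\<^sub>R A))) (at s)"
      by (rule blinfun_exp_compose_has_vector_derivative) (auto intro!: derivative_eq_intros)
    from blinfun_comp.has_vector_derivative[OF blinfun_exp_has_vector_derivative[of A] this]
    show ?thesis
      by (simp add: has_vector_derivative_def blinfun_exp_commute[symmetric]
          blinfun_compose_assoc blinfun_comp.minus_right)
  qed
  then obtain c where c: "\<And>t. ?h t = c"
    using has_derivative_zero_constant[of UNIV ?h] by auto
  have "?h t = id_blinfun" using c[of t] c[of 0] by (simp add: id_blinfun_compose_id)
  then show ?thesis by (metis blinfun_apply_blinfun_compose blinfun_apply_id_blinfun)
qed

section \<open>Linear evolution equations with bounded generators\<close>

text \<open>
  Backward uniqueness: applying the inverse flow to any solution gives a constant, which is the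
  terminal value.
\<close>

lemma adjoint_state_eq:
  fixes C :: "'a::banach \<Rightarrow>\<^sub>L 'a"
  assumes ode: "\<And>t. t \<in> {0..T} \<Longrightarrow> (\<phi> has_vector_derivative - C (\<phi> t)) (at t within {0..T})"
    and s: "s \<in> {0..T}"
  shows "\<phi> s = blinfun_exp ((T - s) *\<^sub>R C) (\<phi> T)"
proof -
  let ?h = "\<lambda>t. blinfun_exp ((t - T) *\<^sub>R C) (\<phi> t)"
  have "(?h has_derivative (\<lambda>h. 0)) (at t within {0..T})" if "t \<in> {0..T}" for t
  proof -
    have "((\<lambda>t. blinfun_exp ((t - T) *\<^sub>R C)) has_vector_derivative
            1 *\<^sub>R (C o\<^sub>L blinfun_exp ((t - T) *\<^sub>R C))) (at t within {0..T})"
      by (rule blinfun_exp_compose_has_vector_derivative) (auto intro!: derivative_eq_intros)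
    from blinfun.has_vector_derivative[OF this ode[OF that]] show ?thesis
      by (simp add: has_vector_derivative_def blinfun.minus_right blinfun_exp_commute[symmetric])
  qed
  then obtain c where c: "\<And>t. t \<in> {0..T} \<Longrightarrow> ?h t = c"
    using has_derivative_zero_constant[of "{0..T}" ?h] by auto
  have "?h s = \<phi> T" using c[OF s] c[of T] s by simp
  moreover have "(s - T) *\<^sub>R C = (- (T - s)) *\<^sub>R C" by simp
  ultimately show ?thesis using blinfun_exp_inverse[of "T - s" C "\<phi> s"] by metis
qed

text \<open>
  The integrand is the derivative of \<open>s \<mapsto> e\<^sup>(\<^sup>T\<^sup>-\<^sup>s\<^sup>)\<^sup>A x(s)\<close>, in which the contributions of the
  generator cancel; the fundamental theorem of calculus does the rest.
\<close>

lemma state_variation_of_constants: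
  fixes A :: "'a::banach \<Rightarrow>\<^sub>L 'a"
  assumes "0 \<le> T"
    and ode: "\<And>t. t \<in> {0..T} \<Longrightarrow> (x has_vector_derivative A (x t) + r t) (at t within {0..T})"
  shows "((\<lambda>s. blinfun_exp ((T - s) *\<^sub>R A) (r s)) has_integral x T - blinfun_exp (T *\<^sub>R A) (x 0)) {0..T}"
proof -
  let ?h = "\<lambda>t. blinfun_exp ((T - t) *\<^sub>R A) (x t)"
  have "(?h has_vector_derivative blinfun_exp ((T - t) *\<^sub>R A) (r t)) (at t within {0..T})"
    if "t \<in> {0..T}" for t
  proof -
    have "((\<lambda>t. blinfun_exp ((T - t) *\<^sub>R A)) has_vector_derivative
            (-1) *\<^sub>R (A o\<^sub>L blinfun_exp ((T - t) *\<^sub>R A))) (at t within {0..T})"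
      by (rule blinfun_exp_compose_has_vector_derivative) (auto intro!: derivative_eq_intros)
    from blinfun.has_vector_derivative[OF this ode[OF that]] show ?thesis
      by (simp add: blinfun.bilinear_simps blinfun_exp_commute[symmetric])
  qed
  from fundamental_theorem_of_calculus[OF \<open>0 \<le> T\<close> this] show ?thesis by simp
qed

lemma state_exists:
  fixes A :: "'a::banach \<Rightarrow>\<^sub>L 'a"
  assumes "continuous_on {0..T} r"
  obtains x where "x 0 = x0"
    and "\<And>t. t \<in> {0..T} \<Longrightarrow> (x has_vector_derivative A (x t) + r t) (at t within {0..T})"
proof -
  define w where "w s = blinfun_exp ((- s) *\<^sub>R A) (r s)" for s
  define x where "x t = blinfun_exp (t *\<^sub>R A) (x0 + integral {0..t} w)" for t
  have "(x has_vector_derivative A (x t) + r t) (at t within {0..T})" if "t \<in> {0..T}" for t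
  proof -
    have "continuous_on {0..T} w"
      unfolding w_def by (intro continuous_intros assms)
    from integral_has_vector_derivative[OF this that]
    have "((\<lambda>t. x0 + integral {0..t} w) has_vector_derivative w t) (at t within {0..T})"
      by (auto intro!: derivative_eq_intros)
    from blinfun.has_vector_derivative[OF blinfun_exp_has_vector_derivative[of A] this]
    show ?thesis
      using blinfun_exp_inverse[of t A "r t"] by (simp add: x_def[abs_def] w_def add.commute)
  qed
  moreover have "x 0 = x0" by (simp add: x_def)
  ultimately show ?thesis using that by blast
qed

section \<open>The Gramian\<close>

text \<open>
  Continuity in the operator norm makes the Gramian a genuine integral, so that it can be estimated
  by the integrand and evaluated pointwise.
\<close>

lemma continuous_on_gramian_integrand:
  fixes A :: "'a::{real_inner, banach} \<Rightarrow>\<^sub>L 'a"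
  shows "continuous_on S (\<lambda>s. blinfun_exp ((T - s) *\<^sub>R A) o\<^sub>L B o\<^sub>L blinfun_inverse R o\<^sub>L blinfun_adjoint B
       o\<^sub>L blinfun_exp ((T - s) *\<^sub>R blinfun_adjoint A))"
  by (intro continuous_intros)

lemma gramian_apply:
  "gramian T R A B p = integral {0..T} (\<lambda>s. blinfun_exp ((T - s) *\<^sub>R A)
     (B (blinfun_inverse R (blinfun_adjoint B (blinfun_exp ((T - s) *\<^sub>R blinfun_adjoint A) p)))))"
  unfolding gramian_def
  by (subst blinfun_apply_integral)
     (auto intro: integrable_continuous_real continuous_on_gramian_integrand)

lemma norm_compose_mono:
  "norm f \<le> c \<Longrightarrow> norm g \<le> d \<Longrightarrow> norm (f o\<^sub>L g) \<le> c * d"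
  using norm_blinfun_compose[of f g] mult_mono'[of "norm f" c "norm g" d] by simp

lemma norm_gramian_le:
  assumes "0 \<le> T" "norm A \<le> a" "norm B \<le> \<beta>"
  shows "norm (gramian T R A B) \<le> exp (T * a) * \<beta> * norm (blinfun_inverse R) * \<beta> * exp (T * a) * T"
proof -
  have "norm (gramian T R A B)
      \<le> exp (T * a) * \<beta> * norm (blinfun_inverse R) * \<beta> * exp (T * a) * (T - 0)"
    unfolding gramian_def
  proof (rule integral_bound[OF \<open>0 \<le> T\<close> continuous_on_gramian_integrand])
    fix s assume s: "s \<in> {0..T}"
    show "norm (blinfun_exp ((T - s) *\<^sub>R A) o\<^sub>L B o\<^sub>L blinfun_inverse R o\<^sub>L blinfun_adjoint B
        o\<^sub>L blinfun_exp ((T - s) *\<^sub>R blinfun_adjoint A))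
      \<le> exp (T * a) * \<beta> * norm (blinfun_inverse R) * \<beta> * exp (T * a)"
      using s assms norm_blinfun_adjoint_le[of A] norm_blinfun_adjoint_le[of B]
      by (intro norm_compose_mono norm_blinfun_exp_scaleR_le) auto
  qed
  then show ?thesis by simp
qed

text \<open>
  The supremum of the operator norms over the parameters is a true upper bound only if it is finite.
  A bound comes from those on \<open>A\<close> and \<open>B\<close> through the integrand of the Gramian.
\<close>

lemma bdd_above_norm_final_operator:
  assumes "0 \<le> T" "bounded (A ` P)" "bounded (B ` P)"
  shows "bdd_above ((\<lambda>\<mu>. norm (final_operator T M R (A \<mu>) (B \<mu>))) ` P)"
proof -
  obtain a \<beta> where bounds: "\<And>\<mu>. \<mu> \<in> P \<Longrightarrow> norm (A \<mu>) \<le> a" "\<And>\<mu>. \<mu> \<in> P \<Longrightarrow> norm (B \<mu>) \<le> \<beta>"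
    using assms(2,3) by (auto simp: bounded_iff)
  show ?thesis
  proof (rule bdd_aboveI2)
    fix \<mu> assume "\<mu> \<in> P"
    then have "norm (M o\<^sub>L gramian T R (A \<mu>) (B \<mu>))
        \<le> norm M * (exp (T * a) * \<beta> * norm (blinfun_inverse R) * \<beta> * exp (T * a) * T)"
      using assms(1) bounds by (intro norm_compose_mono norm_gramian_le) auto
    then show "norm (final_operator T M R (A \<mu>) (B \<mu>))
        \<le> 1 + norm M * (exp (T * a) * \<beta> * norm (blinfun_inverse R) * \<beta> * exp (T * a) * T)"
      unfolding final_operator_def
      by (rule norm_triangle_le[OF add_mono[OF norm_blinfun_id_le]])
  qed
qed

section \<open>Coercive operators\<close>

text \<open>
  The operators \<open>I + M \<Lambda>\<close> are in general not self-adjoint, so the equation is solved by iteration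
  rather than by minimizing an energy. For small \<open>\<rho> > 0\<close> the relaxation \<open>p \<mapsto> p - \<rho> (G p - w)\<close> is a
  contraction: expanding the square gives \<open>\<parallel>d - \<rho> G d\<parallel>\<^sup>2 \<le> (1 - 2\<rho> + \<rho>\<^sup>2 g\<^sup>2) \<parallel>d\<parallel>\<^sup>2\<close> for any bound \<open>g\<close>
  on the norm of \<open>G\<close>. Its fixed point is the solution.
\<close>

lemma coercive_bijective:
  fixes G :: "'a::{real_inner, banach} \<Rightarrow>\<^sub>L 'a"
  assumes coercive: "\<And>p. p \<bullet> p \<le> G p \<bullet> p"
  shows "\<exists>!p. blinfun_apply G p = w"
proof -
  define g \<rho> where "g = norm G + 1" and "\<rho> = 1 / (g\<^sup>2 + 1)"
  have g: "g > 0" by (simp add: g_def add_nonneg_pos)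
  have \<rho>: "0 < \<rho>" "\<rho> \<le> 1" "\<rho> * g\<^sup>2 \<le> 1"
    using g by (auto simp: \<rho>_def add_pos_nonneg field_simps)
  define S where "S p = p - \<rho> *\<^sub>R (G p - w)" for p
  have contr: "dist (S p) (S q) \<le> sqrt (1 - \<rho>) * dist p q" for p q
  proof -
    define d where "d = p - q"
    have Gd: "norm (G d) \<le> g * norm d"
      using norm_blinfun[of G d] by (smt (verit) g_def mult_right_mono norm_ge_zero)
    have "(norm (d - \<rho> *\<^sub>R G d))\<^sup>2 = (norm d)\<^sup>2 - 2 * \<rho> * (G d \<bullet> d) + \<rho>\<^sup>2 * (norm (G d))\<^sup>2"
      unfolding power2_norm_eq_inner
      by (simp add: inner_diff inner_commute power2_eq_square algebra_simps)
    also have "\<dots> \<le> (norm d)\<^sup>2 - 2 * \<rho> * (norm d)\<^sup>2 + \<rho>\<^sup>2 * (g * norm d)\<^sup>2"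
      using coercive[of d] Gd \<rho>
      by (intro add_mono diff_mono mult_left_mono power_mono) (auto simp: power2_norm_eq_inner)
    also have "\<dots> = (norm d)\<^sup>2 * (1 - 2 * \<rho> + \<rho> * (\<rho> * g\<^sup>2))"
      by (simp add: power2_eq_square algebra_simps)
    also have "\<dots> \<le> (norm d)\<^sup>2 * (1 - \<rho>)"
      using \<rho> mult_left_mono[of "\<rho> * g\<^sup>2" 1 \<rho>] by (intro mult_left_mono) auto
    also have "\<dots> = (sqrt (1 - \<rho>) * norm d)\<^sup>2"
      using \<rho> by (simp add: power_mult_distrib)
    finally have "norm (d - \<rho> *\<^sub>R G d) \<le> sqrt (1 - \<rho>) * norm d"
      using \<rho> power2_le_imp_le by fastforce
    moreover have "S p - S q = d - \<rho> *\<^sub>R G d"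
      by (simp add: S_def d_def blinfun.diff_right algebra_simps)
    ultimately show ?thesis by (simp add: dist_norm d_def)
  qed
  have "\<exists>!p. S p = p"
    by (rule banach_fix_type[of "sqrt (1 - \<rho>)"]) (use contr \<rho> in auto)
  then show ?thesis using \<rho> by (simp add: S_def)
qed

text \<open>
  The Cauchy--Schwarz inequality turns coercivity into the estimate that makes the residual an
  upper bound for the error.
\<close>

lemma coercive_lower_bound:
  fixes G :: "'a::real_inner \<Rightarrow>\<^sub>L 'a"
  assumes "\<And>p. p \<bullet> p \<le> G p \<bullet> p"
  shows "norm p \<le> norm (blinfun_apply G p)"
proof -
  have "norm p * norm p \<le> norm (G p) * norm p"
    using assms[of p] norm_cauchy_schwarz[of "G p" p] by (simp add: norm_eq_sqrt_inner)
  then show ?thesis by (cases "p = 0") auto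
qed

section \<open>The optimality system as a linear equation\<close>

lemma final_operator_apply: "final_operator T M R A B p = p + M (gramian T R A B p)"
  by (simp add: final_operator_def blinfun.add_left)

text \<open>
  Inserting the explicit adjoint state into the variation of constants formula leaves exactly the
  integrand of the Gramian, applied to \<open>\<phi> T\<close>. The terminal condition is left out, so the formula
  can also be used to construct a solution that satisfies it.
\<close>

lemma final_state_eq:
  fixes A :: "'x::{real_inner, banach} \<Rightarrow>\<^sub>L 'x" and B :: "'u::{real_inner, banach} \<Rightarrow>\<^sub>L 'x"
  assumes "0 \<le> T"
    and x: "\<And>t. t \<in> {0..T} \<Longrightarrow> (x has_vector_derivative A (x t) + B (u t)) (at t within {0..T})"
    and \<phi>: "\<And>t. t \<in> {0..T} \<Longrightarrow> (\<phi> has_vector_derivative - blinfun_adjoint A (\<phi> t)) (at t within {0..T})"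
    and u: "\<And>t. t \<in> {0..T} \<Longrightarrow> u t = - blinfun_inverse R (blinfun_adjoint B (\<phi> t))"
    and "x 0 = x0"
  shows "x T = blinfun_exp (T *\<^sub>R A) x0 - gramian T R A B (\<phi> T)"
proof -
  let ?Q = "\<lambda>v. B (blinfun_inverse R (blinfun_adjoint B v))"
  have "x T - blinfun_exp (T *\<^sub>R A) x0 = integral {0..T} (\<lambda>s. blinfun_exp ((T - s) *\<^sub>R A) (B (u s)))"
    using state_variation_of_constants[of T x A "\<lambda>t. B (u t)"] x \<open>0 \<le> T\<close> \<open>x 0 = x0\<close>
    by (simp add: integral_unique)
  also have "\<dots> = integral {0..T} (\<lambda>s. - blinfun_exp ((T - s) *\<^sub>R A)
      (?Q (blinfun_exp ((T - s) *\<^sub>R blinfun_adjoint A) (\<phi> T))))"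
  proof (rule Henstock_Kurzweil_Integration.integral_cong)
    fix s assume s: "s \<in> {0..T}"
    have "\<phi> s = blinfun_exp ((T - s) *\<^sub>R blinfun_adjoint A) (\<phi> T)"
      by (rule adjoint_state_eq[OF \<phi> s])
    then show "blinfun_exp ((T - s) *\<^sub>R A) (B (u s)) = - blinfun_exp ((T - s) *\<^sub>R A)
        (?Q (blinfun_exp ((T - s) *\<^sub>R blinfun_adjoint A) (\<phi> T)))"
      by (simp add: u[OF s] blinfun.minus_right)
  qed
  also have "\<dots> = - gramian T R A B (\<phi> T)"
    by (simp add: gramian_apply)
  finally show ?thesis by (simp add: algebra_simps)
qed

lemma optimality_system_final_adjoint:
  assumes "0 \<le> T" and sys: "optimality_system T M R A B x0 xT x u \<phi>"
  shows "final_operator T M R A B (\<phi> T) = final_rhs T M A x0 xT"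
proof -
  have "x T = blinfun_exp (T *\<^sub>R A) x0 - gramian T R A B (\<phi> T)"
    by (rule final_state_eq[where u = u]) (use assms in \<open>auto simp: optimality_system_def\<close>)
  then have "x T - xT = (blinfun_exp (T *\<^sub>R A) x0 - xT) - gramian T R A B (\<phi> T)"
    by (simp add: algebra_simps)
  moreover have "\<phi> T = M (x T - xT)"
    using sys by (simp add: optimality_system_def)
  ultimately have "\<phi> T = M (blinfun_exp (T *\<^sub>R A) x0 - xT) - M (gramian T R A B (\<phi> T))"
    by (simp only: blinfun.diff_right[symmetric])
  then show ?thesis
    unfolding final_operator_apply final_rhs_def eq_diff_eq .
qed

text \<open>
  Start from the candidate \<open>p\<close>, run the adjoint equation backward and then the state equation
  forward. The equation for \<open>p\<close> is what makes the terminal condition hold.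
\<close>

lemma optimality_system_exists:
  assumes "0 \<le> T" and p: "final_operator T M R A B p = final_rhs T M A x0 xT"
  obtains x u \<phi> where "optimality_system T M R A B x0 xT x u \<phi>" and "\<phi> T = p"
proof -
  define \<phi> where "\<phi> t = blinfun_exp ((T - t) *\<^sub>R blinfun_adjoint A) p" for t
  define u where "u t = - blinfun_inverse R (blinfun_adjoint B (\<phi> t))" for t
  have "continuous_on {0..T} (\<lambda>t. B (u t))"
    unfolding u_def \<phi>_def by (intro continuous_intros)
  from state_exists[OF this, of x0 A] obtain x where x: "x 0 = x0"
    "\<And>t. t \<in> {0..T} \<Longrightarrow> (x has_vector_derivative A (x t) + B (u t)) (at t within {0..T})"
    by blast
  have \<phi>': "(\<phi> has_vector_derivative - blinfun_adjoint A (\<phi> t)) (at t within {0..T})" for t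
  proof -
    have "((\<lambda>t. blinfun_exp ((T - t) *\<^sub>R blinfun_adjoint A)) has_vector_derivative
        (-1) *\<^sub>R (blinfun_adjoint A o\<^sub>L blinfun_exp ((T - t) *\<^sub>R blinfun_adjoint A))) (at t within {0..T})"
      by (rule blinfun_exp_compose_has_vector_derivative) (auto intro!: derivative_eq_intros)
    from blinfun.has_vector_derivative[OF this has_vector_derivative_const[of p]]
    show ?thesis by (simp add: \<phi>_def[abs_def] blinfun.minus_left)
  qed
  have \<phi>T: "\<phi> T = p" by (simp add: \<phi>_def)
  have "x T = blinfun_exp (T *\<^sub>R A) x0 - gramian T R A B (\<phi> T)"
    by (rule final_state_eq) (use assms(1) x \<phi>' u_def in auto)
  then have "M (x T - xT) = p"
    using p by (simp only: \<phi>T final_operator_apply final_rhs_def blinfun.diff_right) (simp add: algebra_simps)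
  then have "optimality_system T M R A B x0 xT x u \<phi>"
    using x \<phi>' by (simp add: optimality_system_def u_def \<phi>T)
  then show ?thesis using \<phi>T by (rule that)
qed

lemma final_operator_coercive:
  assumes "positive_semidefinite (M o\<^sub>L gramian T R A B)"
  shows "p \<bullet> p \<le> final_operator T M R A B p \<bullet> p"
  using assms by (simp add: positive_semidefinite_def final_operator_apply inner_add_left)

text \<open>
  Solvability of the optimality system and of the linear equation are equivalent, and the latter has
  exactly one solution by coercivity; hence the description defining the final adjoint is proper.
\<close>

lemma final_operator_optimal_final_adjoint:
  assumes "0 \<le> T" and "positive_semidefinite (M o\<^sub>L gramian T R A B)"
  shows "final_operator T M R A B (optimal_final_adjoint T M R A B x0 xT) = final_rhs T M A x0 xT"
proof -
  let ?solves = "\<lambda>p. final_operator T M R A B p = final_rhs T M A x0 xT"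
  have "\<exists>!p. ?solves p"
    by (intro coercive_bijective final_operator_coercive assms)
  moreover have "?solves = (\<lambda>p. \<exists>x u \<phi>. optimality_system T M R A B x0 xT x u \<phi> \<and> p = \<phi> T)"
  proof (intro ext iffI)
    fix p assume "?solves p"
    from optimality_system_exists[OF assms(1) this]
    show "\<exists>x u \<phi>. optimality_system T M R A B x0 xT x u \<phi> \<and> p = \<phi> T" by metis
  qed (use optimality_system_final_adjoint[OF assms(1)] in blast)
  ultimately show ?thesis
    unfolding optimal_final_adjoint_def using theI'[of ?solves] by simp
qed

section \<open>Orthogonal projection onto finitely generated subspaces\<close>

text \<open>
  One Gram--Schmidt step per generator: if \<open>d\<close> is the part of the new generator \<open>a\<close> orthogonal to the
  old span, the projection of \<open>w\<close> is corrected by its component along \<open>d\<close>. When \<open>a\<close> is dependent on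
  the old generators, \<open>d = 0\<close> and the correction vanishes since division by zero yields zero.
\<close>

lemma orthogonal_projection_exists:
  fixes S :: "'a::real_inner set"
  assumes "finite S"
  shows "\<exists>p\<in>span S. \<forall>y\<in>span S. orthogonal (w - p) y"
  using assms
proof (induction S arbitrary: w)
  case empty
  show ?case by (auto simp: orthogonal_def)
next
  case (insert a S)
  obtain q where q: "q \<in> span S" "\<And>y. y \<in> span S \<Longrightarrow> orthogonal (a - q) y"
    using insert.IH by blast
  obtain p where p: "p \<in> span S" "\<And>y. y \<in> span S \<Longrightarrow> orthogonal (w - p) y"
    using insert.IH by blast
  define d where "d = a - q"
  define p' where "p' = p + (w \<bullet> d / (d \<bullet> d)) *\<^sub>R d"
  have sub: "span S \<subseteq> span (insert a S)" by (rule span_mono) auto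
  have d: "d \<in> span (insert a S)"
    unfolding d_def using q(1) sub by (auto intro: span_diff span_base)
  have "orthogonal (w - p') y" if "y \<in> span S" for y
    using p(2)[OF that] q(2)[OF that]
    by (simp add: orthogonal_def p'_def d_def inner_diff_left inner_add_left)
  moreover have "orthogonal (w - p') a"
  proof -
    have dp: "p \<bullet> d = 0" using q(2)[OF p(1)] by (simp add: d_def orthogonal_def inner_commute)
    have "(w - p') \<bullet> d = w \<bullet> d - (w \<bullet> d / (d \<bullet> d)) * (d \<bullet> d)"
      by (simp add: p'_def inner_diff_left inner_add_left dp)
    also have "\<dots> = 0" by (cases "d = 0") auto
    finally have "(w - p') \<bullet> d = 0" .
    moreover have "(w - p') \<bullet> q = 0"
      using calculation \<open>q \<in> span S\<close> \<open>\<And>y. y \<in> span S \<Longrightarrow> orthogonal (w - p') y\<close>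
      by (simp add: orthogonal_def)
    ultimately show ?thesis by (simp add: orthogonal_def d_def inner_diff_right)
  qed
  ultimately have "orthogonal (w - p') y" if "y \<in> span (insert a S)" for y
    using that by (intro orthogonal_to_span[OF that]) (auto intro: span_base)
  moreover have "p' \<in> span (insert a S)"
    unfolding p'_def using p(1) sub d by (auto intro: span_add span_scale)
  ultimately show ?case by blast
qed

lemma orth_projection_span:
  fixes S :: "'a::real_inner set"
  assumes "finite S"
  shows "orth_projection (span S) w \<in> span S"
    and "y \<in> span S \<Longrightarrow> orthogonal (w - orth_projection (span S) w) y"
proof -
  let ?proj = "\<lambda>p. p \<in> span S \<and> (\<forall>y\<in>span S. orthogonal (w - p) y)"
  have "p = q" if "?proj p" "?proj q" for p q
  proof -
    have "p - q \<in> span S" using that by (auto intro: span_diff)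
    then have "orthogonal (w - p) (p - q)" "orthogonal (w - q) (p - q)" using that by auto
    then have "(p - q) \<bullet> (p - q) = 0"
      by (simp add: orthogonal_def inner_diff_left)
    then show ?thesis by simp
  qed
  then have "\<exists>!p. ?proj p" using orthogonal_projection_exists[OF assms, of w] by blast
  then have "?proj (orth_projection (span S) w)"
    unfolding orth_projection_def by (rule theI')
  then show "orth_projection (span S) w \<in> span S"
    "y \<in> span S \<Longrightarrow> orthogonal (w - orth_projection (span S) w) y" by auto
qed

lemma orth_projection_best_approximation:
  fixes S :: "'a::real_inner set"
  assumes "finite S" "y \<in> span S"
  shows "norm (w - orth_projection (span S) w) \<le> norm (w - y)"
proof -
  let ?p = "orth_projection (span S) w"
  have "orthogonal (w - ?p) (?p - y)"
    using orth_projection_span[OF assms(1)] assms(2) by (auto intro: span_diff)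
  from norm_add_Pythagorean[OF this] have "(norm (w - ?p))\<^sup>2 \<le> (norm (w - y))\<^sup>2" by simp
  then show ?thesis by (rule power2_le_imp_le) simp
qed

section \<open>Error estimator and greedy selection\<close>

text \<open>
  Coefficients indexed by positions allow lists with repeated entries, where coefficients indexed by
  vectors would count an entry several times.
\<close>

lemma in_span_set_iff_sum_nth:
  "y \<in> span (set xs) \<longleftrightarrow> (\<exists>c. y = (\<Sum>i<length xs. c i *\<^sub>R xs ! i))"
  for y :: "'a::real_vector"
proof
  show "\<exists>c. y = (\<Sum>i<length xs. c i *\<^sub>R xs ! i)" if "y \<in> span (set xs)"
    using that
  proof (induction xs arbitrary: y rule: rev_induct)
    case Nil
    then show ?case by simp
  next
    case (snoc x xs)
    then obtain k where "y - k *\<^sub>R x \<in> span (set xs)" by (auto simp: span_insert)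
    with snoc.IH obtain c where "y - k *\<^sub>R x = (\<Sum>i<length xs. c i *\<^sub>R xs ! i)" by blast
    then have "y = (\<Sum>i<length (xs @ [x]). (c(length xs := k)) i *\<^sub>R (xs @ [x]) ! i)"
      by (simp add: nth_append algebra_simps)
    then show ?case by blast
  qed
  show "y \<in> span (set xs)" if "\<exists>c. y = (\<Sum>i<length xs. c i *\<^sub>R xs ! i)"
    using that by (auto intro!: span_sum span_scale intro: span_base)
qed

lemma reduced_adjoint_span:
  fixes G :: "'a::real_inner \<Rightarrow>\<^sub>L 'a"
  shows "reduced_adjoint G b \<Phi> \<in> span (set \<Phi>)"
  unfolding reduced_adjoint_def Let_def in_span_set_iff_sum_nth by blast

text \<open>
  Whatever coefficients are chosen, the image under \<open>G\<close> is the orthogonal projection of \<open>b\<close>. This is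
  why linear dependence of the images does no harm.
\<close>

lemma apply_reduced_adjoint:
  fixes G :: "'a::real_inner \<Rightarrow>\<^sub>L 'a"
  shows "G (reduced_adjoint G b \<Phi>) = orth_projection (span (blinfun_apply G ` set \<Phi>)) b"
proof -
  let ?p = "orth_projection (span (blinfun_apply G ` set \<Phi>)) b"
  have "?p \<in> span (blinfun_apply G ` set \<Phi>)" by (rule orth_projection_span) simp
  then obtain y where "y \<in> span (set \<Phi>)" "?p = G y"
    using linear_span_image[OF bounded_linear.linear[OF blinfun.bounded_linear_right]] by blast
  then obtain c where "?p = G (\<Sum>i<length \<Phi>. c i *\<^sub>R \<Phi> ! i)"
    unfolding in_span_set_iff_sum_nth by blast
  then have "\<exists>c. (\<Sum>i<length \<Phi>. c i *\<^sub>R G (\<Phi> ! i)) = ?p"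
    by (auto simp: blinfun.sum_right blinfun.scaleR_right)
  from someI_ex[OF this] show ?thesis
    by (simp add: reduced_adjoint_def Let_def blinfun.sum_right blinfun.scaleR_right)
qed

text \<open>
  Since \<open>reduced_adjoint\<close> projects the right-hand side, the estimate is the least residual over the
  whole reduced space, not merely the residual of one approximation.
\<close>

lemma greedy_estimate_le_residual:
  fixes G :: "'p \<Rightarrow> 'x::real_inner \<Rightarrow>\<^sub>L 'x"
  assumes "y \<in> span (set \<Phi>)"
  shows "greedy_estimate G b \<Phi> \<mu> \<le> norm (b \<mu> - G \<mu> y)"
proof -
  have "G \<mu> y \<in> span (blinfun_apply (G \<mu>) ` set \<Phi>)"
    using assms linear_span_image[OF bounded_linear.linear[OF blinfun.bounded_linear_right[of "G \<mu>"]]]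
    by blast
  from orth_projection_best_approximation[OF _ this] show ?thesis
    by (simp add: greedy_estimate_def error_estimator_def apply_reduced_adjoint)
qed

lemma space_dist_singleton:
  assumes "Y \<noteq> {}" shows "space_dist Y {z} = infdist z Y"
  using assms by (simp add: space_dist_def infdist_def dist_norm norm_minus_commute)

lemma space_dist_le:
  assumes "Y \<noteq> {}" "Z \<noteq> {}" "\<And>z. z \<in> Z \<Longrightarrow> infdist z Y \<le> c"
  shows "space_dist Y Z \<le> c"
  using assms by (auto simp: space_dist_def infdist_def dist_norm norm_minus_commute intro: cSUP_least)

text \<open>
  Reliability: the reduced adjoint lies in the reduced space, and its error is at most its residual
  because \<open>G\<close> does not shrink norms.
\<close>

lemma infdist_le_greedy_estimate:
  fixes G :: "'p \<Rightarrow> 'x::real_inner \<Rightarrow>\<^sub>L 'x"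
  assumes "\<And>p. norm p \<le> norm (G \<mu> p)" "G \<mu> (\<phi> \<mu>) = b \<mu>"
  shows "infdist (\<phi> \<mu>) (span (set \<Phi>)) \<le> greedy_estimate G b \<Phi> \<mu>"
proof -
  let ?r = "reduced_adjoint (G \<mu>) (b \<mu>) \<Phi>"
  have "infdist (\<phi> \<mu>) (span (set \<Phi>)) \<le> norm (\<phi> \<mu> - ?r)"
    using infdist_le[OF reduced_adjoint_span] by (simp add: dist_norm)
  also have "\<dots> \<le> norm (G \<mu> (\<phi> \<mu> - ?r))" by (rule assms)
  finally show ?thesis
    using assms(2) by (simp add: greedy_estimate_def error_estimator_def blinfun.diff_right)
qed

text \<open>
  Efficiency: every element of the reduced space competes in the least residual, and its residual is
  at most \<open>C\<close> times its error.
\<close>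

lemma greedy_estimate_le_infdist:
  fixes G :: "'p \<Rightarrow> 'x::real_inner \<Rightarrow>\<^sub>L 'x"
  assumes "norm (G \<mu>) \<le> C" "0 < C" "G \<mu> (\<phi> \<mu>) = b \<mu>"
  shows "greedy_estimate G b \<Phi> \<mu> \<le> C * infdist (\<phi> \<mu>) (span (set \<Phi>))"
proof -
  have nonempty: "span (set \<Phi>) \<noteq> {}" using span_zero by blast
  have "greedy_estimate G b \<Phi> \<mu> / C \<le> infdist (\<phi> \<mu>) (span (set \<Phi>))"
    unfolding infdist_notempty[OF nonempty]
  proof (rule cINF_greatest[OF nonempty])
    fix y assume y: "y \<in> span (set \<Phi>)"
    have "greedy_estimate G b \<Phi> \<mu> \<le> norm (G \<mu> (\<phi> \<mu> - y))"
      using greedy_estimate_le_residual[OF y, of G b] assms(3) by (simp add: blinfun.diff_right)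
    also have "\<dots> \<le> C * norm (\<phi> \<mu> - y)"
      using norm_blinfun[of "G \<mu>" "\<phi> \<mu> - y"] assms(1) by (meson mult_right_mono norm_ge_zero order_trans)
    finally show "greedy_estimate G b \<Phi> \<mu> / C \<le> dist (\<phi> \<mu>) y"
      using assms(2) by (simp add: dist_norm divide_le_eq mult.commute)
  qed
  then show ?thesis using assms(2) by (simp add: divide_le_eq mult.commute)
qed

text \<open>
  This holds also when \<open>w\<close> already lies in the span: then \<open>sgn 0 = 0\<close> is appended and neither side
  grows. In general, \<open>w\<close> is recovered from its projection and the normalized vector.
\<close>

lemma span_insert_gram_schmidt:
  "span (insert (gram_schmidt_normalized \<Phi> w) (set \<Phi>)) = span (insert w (set \<Phi>))"
proof -
  let ?S = "set \<Phi>"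
  define p where "p = orth_projection (span ?S) w"
  define c where "c = inverse (norm (w - p))"
  define g where "g = c *\<^sub>R (w - p)"
  have p: "p \<in> span ?S" unfolding p_def by (rule orth_projection_span) simp
  have sub: "span ?S \<subseteq> span (insert v ?S)" for v by (rule span_mono) auto
  have "g \<in> span (insert w ?S)"
    unfolding g_def using p sub by (auto intro!: span_scale span_diff intro: span_base)
  moreover have "w \<in> span (insert g ?S)"
  proof -
    have "w = p + norm (w - p) *\<^sub>R g" by (cases "w = p") (simp_all add: g_def c_def)
    then show ?thesis using p sub by (metis in_mono insertI1 span_add span_base span_scale)
  qed
  ultimately have "span (insert g ?S) = span (insert w ?S)"
    unfolding span_eq by (auto intro: span_base)
  then show ?thesis
    by (simp add: gram_schmidt_normalized_def sgn_div_norm p_def[symmetric] g_def c_def)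
qed

lemma greedy_run_span_Suc:
  assumes "greedy_run train tol \<phi> G b N \<nu> \<Phi>" "k < N"
  shows "span (set (\<Phi> (Suc k))) = {y + z | y z. y \<in> span (set (\<Phi> k)) \<and> z \<in> span {\<phi> (\<nu> (Suc k))}}"
proof -
  have "span (set (\<Phi> (Suc k))) = span (insert (\<phi> (\<nu> (Suc k))) (set (\<Phi> k)))"
    using assms span_insert_gram_schmidt by (force simp: greedy_run_def)
  then show ?thesis
    using span_Un[of "set (\<Phi> k)" "{\<phi> (\<nu> (Suc k))}"] by auto
qed

text \<open>
  Move from \<open>\<mu>\<close> to a training parameter at the cost of the Lipschitz constant times \<open>\<delta>\<close>; there the
  error is bounded by the estimate, which is largest at the selected parameter.
\<close>

lemma infdist_le_training:
  fixes \<phi> :: "'p::real_normed_vector \<Rightarrow> 'x::real_inner" and G :: "'p \<Rightarrow> 'x \<Rightarrow>\<^sub>L 'x"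
  assumes lip: "C_phi-lipschitz_on P \<phi>"
    and train: "train \<subseteq> P" "\<And>\<mu>. \<mu> \<in> P \<Longrightarrow> \<exists>\<mu>'\<in>train. norm (\<mu> - \<mu>') \<le> \<delta>"
    and lower: "\<And>\<mu> p. \<mu> \<in> P \<Longrightarrow> norm p \<le> norm (G \<mu> p)"
    and sol: "\<And>\<mu>. \<mu> \<in> P \<Longrightarrow> G \<mu> (\<phi> \<mu>) = b \<mu>"
    and select: "greedy_select train G b \<Phi> \<nu>" and "\<mu> \<in> P"
  shows "infdist (\<phi> \<mu>) (span (set \<Phi>)) \<le> C_phi * \<delta> + greedy_estimate G b \<Phi> \<nu>"
proof -
  obtain \<mu>' where \<mu>': "\<mu>' \<in> train" "norm (\<mu> - \<mu>') \<le> \<delta>" using train(2) \<open>\<mu> \<in> P\<close> by blast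
  then have P: "\<mu>' \<in> P" using train(1) by blast
  have "infdist (\<phi> \<mu>) (span (set \<Phi>)) \<le> infdist (\<phi> \<mu>') (span (set \<Phi>)) + dist (\<phi> \<mu>) (\<phi> \<mu>')"
    by (rule infdist_triangle)
  moreover have "dist (\<phi> \<mu>) (\<phi> \<mu>') \<le> C_phi * \<delta>"
    using lipschitz_onD[OF lip \<open>\<mu> \<in> P\<close> P] \<mu>'(2) lipschitz_on_nonneg[OF lip]
    by (metis dist_norm mult_left_mono order_trans)
  moreover have "infdist (\<phi> \<mu>') (span (set \<Phi>)) \<le> greedy_estimate G b \<Phi> \<mu>'"
    by (intro infdist_le_greedy_estimate lower sol P)
  moreover have "greedy_estimate G b \<Phi> \<mu>' \<le> greedy_estimate G b \<Phi> \<nu>"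
    using select \<mu>'(1) by (auto simp: greedy_select_def is_arg_max_linorder)
  ultimately show ?thesis by linarith
qed

text \<open>
  As long as the procedure continues, the estimate exceeds \<open>C * \<delta>\<close>. Being at most \<open>C\<close> times the distance
  at the selected parameter, it forces \<open>\<delta>\<close> below that distance. Hence the price of leaving the
  training set is absorbed into the factor \<open>C_phi\<close>.
\<close>

lemma weak_greedy_inequality:
  fixes \<phi> :: "'p::real_normed_vector \<Rightarrow> 'x::real_inner" and G :: "'p \<Rightarrow> 'x \<Rightarrow>\<^sub>L 'x"
  assumes lip: "C_phi-lipschitz_on P \<phi>"
    and train: "train \<subseteq> P" "\<And>\<mu>. \<mu> \<in> P \<Longrightarrow> \<exists>\<mu>'\<in>train. norm (\<mu> - \<mu>') \<le> \<delta>"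
    and lower: "\<And>\<mu> p. \<mu> \<in> P \<Longrightarrow> norm p \<le> norm (G \<mu> p)"
    and upper: "\<And>\<mu>. \<mu> \<in> P \<Longrightarrow> norm (G \<mu>) \<le> C" and "0 < C"
    and sol: "\<And>\<mu>. \<mu> \<in> P \<Longrightarrow> G \<mu> (\<phi> \<mu>) = b \<mu>"
    and select: "greedy_select train G b \<Phi> \<nu>"
    and large: "C * \<delta> < greedy_estimate G b \<Phi> \<nu>"
    and "\<mu> \<in> P"
  shows "infdist (\<phi> \<mu>) (span (set \<Phi>)) \<le> (C_phi + C) * infdist (\<phi> \<nu>) (span (set \<Phi>))"
proof -
  let ?d = "infdist (\<phi> \<nu>) (span (set \<Phi>))"
  have "\<nu> \<in> P" using select train(1) by (auto simp: greedy_select_def is_arg_max_linorder)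
  then have est: "greedy_estimate G b \<Phi> \<nu> \<le> C * ?d"
    by (intro greedy_estimate_le_infdist upper sol \<open>0 < C\<close>)
  with large have "C * \<delta> \<le> C * ?d" by linarith
  then have "\<delta> \<le> ?d" using \<open>0 < C\<close> by simp
  then have "C_phi * \<delta> \<le> C_phi * ?d"
    using lipschitz_on_nonneg[OF lip] by (rule mult_left_mono)
  moreover have "infdist (\<phi> \<mu>) (span (set \<Phi>)) \<le> C_phi * \<delta> + greedy_estimate G b \<Phi> \<nu>"
    by (rule infdist_le_training[OF lip train lower sol select \<open>\<mu> \<in> P\<close>])
  ultimately show ?thesis
    using est by (simp add: distrib_right)
qed

section \<open>The greedy procedure\<close>

theorem theorem5:
  fixes P train :: "'p::banach set"
    and A :: "'p \<Rightarrow> 'x::{real_inner, banach} \<Rightarrow>\<^sub>L 'x"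
    and B :: "'p \<Rightarrow> 'u::{real_inner, banach} \<Rightarrow>\<^sub>L 'x"
    and x0 xT \<phi> b :: "'p \<Rightarrow> 'x"
    and M :: "'x \<Rightarrow>\<^sub>L 'x" and R :: "'u \<Rightarrow>\<^sub>L 'u"
    and G :: "'p \<Rightarrow> 'x \<Rightarrow>\<^sub>L 'x"
    and T \<alpha> C_phi C_Lambda \<gamma> \<epsilon> tol \<delta> :: real
  assumes "(UNIV :: 'x set) \<noteq> {0}"
    and "T > 0"
    and "compact P" and "P \<noteq> {}"
    and "\<exists>L. L-lipschitz_on P A" and "\<exists>L. L-lipschitz_on P B"
    and "\<exists>L. L-lipschitz_on P x0" and "\<exists>L. L-lipschitz_on P xT"
    and "selfadjoint M" and "positive_semidefinite M"
    and "selfadjoint R" and "\<alpha> > 0" and "\<And>u. R u \<bullet> u \<ge> \<alpha> * (u \<bullet> u)"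
    and "\<And>\<mu>. \<mu> \<in> P \<Longrightarrow> positive_semidefinite (M o\<^sub>L gramian T R (A \<mu>) (B \<mu>))"
    and "\<phi> = (\<lambda>\<mu>. optimal_final_adjoint T M R (A \<mu>) (B \<mu>) (x0 \<mu>) (xT \<mu>))"
    and "G = (\<lambda>\<mu>. final_operator T M R (A \<mu>) (B \<mu>))"
    and "b = (\<lambda>\<mu>. final_rhs T M (A \<mu>) (x0 \<mu>) (xT \<mu>))"
    and "C_phi-lipschitz_on P \<phi>"
    and "C_Lambda = (SUP \<mu>\<in>P. norm (G \<mu>))"
    and "\<gamma> = 1 / (C_phi + C_Lambda)"
    and "\<epsilon> > 0" and "tol = C_Lambda * \<gamma> * \<epsilon>" and "\<delta> = tol / C_Lambda"
    and "finite train" and "train \<subseteq> P"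
    and "\<And>\<mu>. \<mu> \<in> P \<Longrightarrow> \<exists>\<mu>'\<in>train. norm (\<mu> - \<mu>') \<le> \<delta>"
  shows "(\<forall>N \<nu> \<Phi>. greedy_run train tol \<phi> G b N \<nu> \<Phi> \<longrightarrow>
            weak_greedy \<gamma> (\<phi> ` P) N (\<lambda>k. span (set (\<Phi> k))) (\<lambda>k. \<phi> (\<nu> k))) \<and>
         (\<forall>N \<nu> \<Phi>. greedy_terminates train tol \<phi> G b N \<nu> \<Phi> \<longrightarrow>
            (\<forall>\<mu>\<in>P. space_dist (span (set (\<Phi> N))) {\<phi> \<mu>} \<le> \<epsilon>))"
proof -
  note nontrivial = assms(1) and T = assms(2) and P = assms(3,4)
    and psd = assms(14) and \<phi> = assms(15) and G = assms(16) and b = assms(17)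
    and lip = assms(18) and C = assms(19) and \<gamma> = assms(20) and \<epsilon> = assms(21)
    and tol = assms(22) and \<delta> = assms(23) and train = assms(25,26)
  have "bounded (A ` P)" "bounded (B ` P)"
    using assms(5,6) P(1)
    by (auto intro!: compact_imp_bounded compact_continuous_image lipschitz_on_continuous_on)
  then have "bdd_above ((\<lambda>\<mu>. norm (G \<mu>)) ` P)"
    unfolding G using T by (intro bdd_above_norm_final_operator) auto
  then have upper: "norm (G \<mu>) \<le> C_Lambda" if "\<mu> \<in> P" for \<mu>
    unfolding C using that by (intro cSUP_upper)
  have lower: "norm p \<le> norm (G \<mu> p)" if "\<mu> \<in> P" for \<mu> p
    unfolding G by (intro coercive_lower_bound final_operator_coercive psd that)
  have sol: "G \<mu> (\<phi> \<mu>) = b \<mu>" if "\<mu> \<in> P" for \<mu>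
    unfolding G \<phi> b using T psd[OF that] by (intro final_operator_optimal_final_adjoint) auto
  \<comment> \<open>On a nonzero vector, an operator that does not shrink norms has norm at least one.\<close>
  have C1: "1 \<le> C_Lambda"
  proof -
    obtain \<mu> where \<mu>: "\<mu> \<in> P" using P(2) by blast
    obtain p :: 'x where "p \<noteq> 0" using nontrivial by blast
    moreover have "norm p \<le> norm (G \<mu>) * norm p"
      using lower[OF \<mu>] norm_blinfun order_trans by blast
    ultimately have "1 \<le> norm (G \<mu>)" by simp
    then show ?thesis using upper[OF \<mu>] by linarith
  qed
  have Cphi: "0 \<le> C_phi" by (rule lipschitz_on_nonneg[OF lip])
  have \<gamma>01: "0 < \<gamma>" "\<gamma> \<le> 1" using C1 Cphi by (auto simp: \<gamma>)
  have tol_eq: "tol = C_Lambda * \<delta>" using C1 by (simp add: \<delta>)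
  have \<delta>_eq: "\<delta> = \<gamma> * \<epsilon>" using C1 by (simp add: \<delta> tol)
  have nonempty: "span S \<noteq> {}" for S :: "'x set" using span_zero by blast
  show ?thesis
  proof (intro conjI allI impI ballI)
    fix N \<nu> \<Phi> assume run: "greedy_run train tol \<phi> G b N \<nu> \<Phi>"
    show "weak_greedy \<gamma> (\<phi> ` P) N (\<lambda>k. span (set (\<Phi> k))) (\<lambda>k. \<phi> (\<nu> k))"
      unfolding weak_greedy_def
    proof (intro conjI allI impI \<gamma>01)
      show "compact (\<phi> ` P)"
        by (rule compact_continuous_image[OF lipschitz_on_continuous_on[OF lip] P(1)])
      show "span (set (\<Phi> 0)) = {0}" using run by (simp add: greedy_run_def)
    next
      fix k assume k: "k < N"
      have select: "greedy_select train G b (\<Phi> k) (\<nu> (Suc k))"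
        and large: "C_Lambda * \<delta> < greedy_estimate G b (\<Phi> k) (\<nu> (Suc k))"
        using run k by (auto simp: greedy_run_def tol_eq)
      show "\<phi> (\<nu> (Suc k)) \<in> \<phi> ` P"
        using select train(1) by (auto simp: greedy_select_def is_arg_max_linorder)
      show "span (set (\<Phi> (Suc k)))
          = {y + z | y z. y \<in> span (set (\<Phi> k)) \<and> z \<in> span {\<phi> (\<nu> (Suc k))}}"
        by (rule greedy_run_span_Suc[OF run k])
      have "space_dist (span (set (\<Phi> k))) (\<phi> ` P)
          \<le> (C_phi + C_Lambda) * infdist (\<phi> (\<nu> (Suc k))) (span (set (\<Phi> k)))"
        using weak_greedy_inequality[OF lip train lower upper _ sol select large] C1 P(2)
        by (intro space_dist_le nonempty) auto
      then show "\<gamma> * space_dist (span (set (\<Phi> k))) (\<phi> ` P)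
          \<le> space_dist (span (set (\<Phi> k))) {\<phi> (\<nu> (Suc k))}"
        using C1 Cphi by (simp add: space_dist_singleton[OF nonempty] \<gamma> divide_le_eq mult.commute)
    qed
  next
    fix N \<nu> \<Phi> \<mu> assume "greedy_terminates train tol \<phi> G b N \<nu> \<Phi>" and "\<mu> \<in> P"
    then have select: "greedy_select train G b (\<Phi> N) (\<nu> (Suc N))"
      and small: "greedy_estimate G b (\<Phi> N) (\<nu> (Suc N)) \<le> C_Lambda * \<delta>"
      by (auto simp: greedy_terminates_def tol_eq)
    have "infdist (\<phi> \<mu>) (span (set (\<Phi> N))) \<le> (C_phi + C_Lambda) * \<delta>"
      using infdist_le_training[OF lip train lower sol select \<open>\<mu> \<in> P\<close>] small
      by (simp add: distrib_right)
    also have "\<dots> = \<epsilon>" using C1 Cphi by (simp add: \<delta>_eq \<gamma>)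
    finally show "space_dist (span (set (\<Phi> N))) {\<phi> \<mu>} \<le> \<epsilon>"
      by (simp add: space_dist_singleton[OF nonempty])
  qed
qed

end
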